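(* Let $p\in(0,1/2)$ be a fixed constant and let $\delta=\delta_n$ satisfy $\delta_n\to0$ as $n\to\infty$. Then there exists an algorithm for the noisy $\mathsf{MAX}$ problem on $n$ real numbers that, for every input, outputs the maximum with error probability at most $\delta$, and whose expected number of queries on every input is at most \[ (1+o(1))\frac{n\log\frac1\delta}{D_{\mathsf{KL}}(p\|1-p)}, \] where the $o(1)$ term tends to $0$ as $n\to\infty$ uniformly over inputs.
   Context: Noisy $\mathsf{MAX}$ problem: an unknown sequence $\mathbf{x}=(x_1,\dots,x_n)$ of distinct reals; the goal is to find $\mathsf{MAX}(\mathbf{x})=\arg\max_i x_i$. Each query is an adaptively chosen pair $(i,j)$ and returns $\mathbb{1}\{x_i<x_j\}\oplus Z$ with $Z\sim\mathrm{Bern}(p)$ i.i.d. across queries; the number of queries may be random and data-dependent. Logarithms are natural and $D_{\mathsf{KL}}(p\|1-p)=(1-2p)\log\frac{1-p}{p}$. *)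

theory Defs
  imports "HOL-Probability.Probability"
begin

text \<open>
  The items are indexed by \<open>{..<n}\<close> and their values are \<open>x 0, \<dots>, x (n - 1)\<close>.
  A deterministic strategy maps the list of past queries with their answers (in chronological
  order) to its next action; a randomised algorithm is a distribution over deterministic
  strategies.
\<close>

datatype action = Query nat nat | Output nat

type_synonym history = "((nat \<times> nat) \<times> bool) list"
type_synonym strategy = "history \<Rightarrow> action"
type_synonym algorithm = "strategy pmf"

definition valid_algorithm :: "nat \<Rightarrow> algorithm \<Rightarrow> bool" where
  "valid_algorithm n A \<longleftrightarrow>
     (\<forall>\<sigma>\<in>set_pmf A. \<forall>h i j. \<sigma> h = Query i j \<longrightarrow> i < n \<and> j < n \<and> i \<noteq> j)"

text \<open>
  The distribution of the transcript after at most \<open>t\<close> queries; it no longer changes once the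
  strategy has produced an output. On Booleans, \<open>\<noteq>\<close> is exclusive or.
\<close>

primrec transcript :: "real \<Rightarrow> (nat \<Rightarrow> real) \<Rightarrow> strategy \<Rightarrow> nat \<Rightarrow> history pmf" where
  "transcript p x \<sigma> 0 = return_pmf []"
| "transcript p x \<sigma> (Suc t) =
     bind_pmf (transcript p x \<sigma> t) (\<lambda>h.
       case \<sigma> h of
         Query i j \<Rightarrow> map_pmf (\<lambda>z. h @ [((i, j), (x i < x j) \<noteq> z)]) (bernoulli_pmf p)
       | Output k \<Rightarrow> return_pmf h)"

definition execution :: "real \<Rightarrow> (nat \<Rightarrow> real) \<Rightarrow> algorithm \<Rightarrow> nat \<Rightarrow> (strategy \<times> history) pmf" where
  "execution p x A t = bind_pmf A (\<lambda>\<sigma>. map_pmf (Pair \<sigma>) (transcript p x \<sigma> t))"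

text \<open>
  The events below decrease in \<open>t\<close>, so the infimum is the probability of their intersection,
  i.e. of never outputting the maximum. A run that does not terminate thus counts as an error.
\<close>

definition error_prob :: "real \<Rightarrow> nat \<Rightarrow> (nat \<Rightarrow> real) \<Rightarrow> algorithm \<Rightarrow> real" where
  "error_prob p n x A =
     (INF t. measure_pmf.prob (execution p x A t) {(\<sigma>, h). \<sigma> h \<noteq> Output (arg_max_on x {..<n})})"

text \<open>
  By monotone convergence, the supremum is the expectation of the (possibly infinite) total
  number of queries.
\<close>

definition expected_queries :: "real \<Rightarrow> (nat \<Rightarrow> real) \<Rightarrow> algorithm \<Rightarrow> ennreal" where
  "expected_queries p x A =
     (SUP t. \<integral>\<^sup>+ (\<sigma>, h). of_nat (length h) \<partial>measure_pmf (execution p x A t))"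

text \<open>
  In the library, \<open>KL_divergence b M N\<close> is the divergence of \<open>N\<close> from the reference measure \<open>M\<close>,
  i.e. \<open>D(N \<parallel> M)\<close>, so the arguments appear in reversed order.
\<close>

definition D_KL :: "real \<Rightarrow> real \<Rightarrow> real" where
  "D_KL p q =
     KL_divergence (exp 1) (measure_pmf (bernoulli_pmf q)) (measure_pmf (bernoulli_pmf p))"

lemma D_KL_complement:
  assumes "0 < p" "p < 1"
  shows "D_KL p (1 - p) = (1 - 2 * p) * ln ((1 - p) / p)"
proof -
  interpret sigma_finite_measure "count_space (UNIV :: bool set)"
    by (rule sigma_finite_measure_count_space)
  have pos: "pmf (bernoulli_pmf (1 - p)) b \<noteq> 0" for b
    using assms by (cases b) auto
  have "D_KL p (1 - p) = (\<integral>b. pmf (bernoulli_pmf p) b *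
      log (exp 1) (pmf (bernoulli_pmf p) b / pmf (bernoulli_pmf (1 - p)) b) \<partial>count_space UNIV)"
    unfolding D_KL_def measure_pmf_eq_density
    by (rule KL_density_density)
       (auto simp: AE_count_space pos)
  also have "\<dots> = p * ln (p / (1 - p)) + (1 - p) * ln ((1 - p) / p)"
    using assms by (simp add: lebesgue_integral_count_space_finite UNIV_bool log_def)
  also have "\<dots> = (1 - 2 * p) * ln ((1 - p) / p)"
    using assms by (simp add: ln_div algebra_simps)
  finally show ?thesis .
qed

end

theory Submission
  imports Defs
begin

text \<open>
  Run a knockout tournament on a queue: the two front elements are compared and the winner goes to
  the back. Each comparison is a sequential probability ratio test: a counter moves by one per
  answer until it reaches \<open>\<plusminus>a k\<close>, where \<open>k\<close> is the current length of the queue. It costs at most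
  \<open>a k / (1 - 2 * p)\<close> queries on average and errs with probability at most \<open>(p / (1 - p)) ^ a k\<close>.
  Choosing \<open>a k\<close> so that this is at most \<open>\<delta> * (k - 1) / (2 * n)\<close>, the errors along the
  comparisons of the maximum decay geometrically and sum to at most \<open>\<delta>\<close>, while the average of
  \<open>ln (2 * n / (k - 1))\<close> over \<open>k\<close> is bounded, so that the cost is \<open>n * (ln (1 / \<delta>) + O(1))\<close>
  divided by the divergence.

  Both estimates are carried out by potential functions on the state of the tournament that are
  supermartingales along the transcript.
\<close>

section \<open>Potential functions along transcripts\<close>

definition play :: "('s \<Rightarrow> bool \<Rightarrow> 's) \<Rightarrow> 's \<Rightarrow> history \<Rightarrow> 's" where
  "play f s h = foldl f s (map snd h)"

lemma play_Nil [simp]: "play f s [] = s"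
  by (simp add: play_def)

lemma play_snoc [simp]: "play f s (h @ [(q, b)]) = f (play f s h) b"
  by (simp add: play_def)

lemma play_invariant:
  assumes "I s" "\<And>s b. I s \<Longrightarrow> I (f s b)"
  shows "I (play f s h)"
  using assms(1) by (induction h rule: rev_induct) (auto intro: assms(2))

text \<open>This is the supermartingale inequality. The transcript freezes after an output, so an
  inequality at querying histories suffices for the induction on \<open>t\<close>.\<close>

lemma nn_integral_transcript_le:
  fixes \<phi> :: "history \<Rightarrow> real"
  assumes p: "0 \<le> p" "p \<le> 1" and nonneg: "\<And>h. 0 \<le> \<phi> h"
    and step: "\<And>h i j. \<sigma> h = Query i j \<Longrightarrow>
      (1 - p) * \<phi> (h @ [((i, j), x i < x j)]) + p * \<phi> (h @ [((i, j), \<not> x i < x j)]) \<le> \<phi> h"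
  shows "(\<integral>\<^sup>+ h. ennreal (\<phi> h) \<partial>measure_pmf (transcript p x \<sigma> t)) \<le> ennreal (\<phi> [])"
proof (induction t)
  case 0
  show ?case by (simp add: nn_integral_return_pmf)
next
  case (Suc t)
  have "(\<integral>\<^sup>+ h. ennreal (\<phi> h) \<partial>measure_pmf (transcript p x \<sigma> (Suc t))) \<le>
        (\<integral>\<^sup>+ h. ennreal (\<phi> h) \<partial>measure_pmf (transcript p x \<sigma> t))"
    unfolding transcript.simps nn_integral_bind_pmf
  proof (rule nn_integral_mono)
    fix h
    show "(\<integral>\<^sup>+ h'. ennreal (\<phi> h') \<partial>measure_pmf (case \<sigma> h of
            Query i j \<Rightarrow> map_pmf (\<lambda>z. h @ [((i, j), (x i < x j) \<noteq> z)]) (bernoulli_pmf p)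
          | Output k \<Rightarrow> return_pmf h)) \<le> ennreal (\<phi> h)"
    proof (cases "\<sigma> h")
      case (Query i j)
      let ?good = "\<phi> (h @ [((i, j), x i < x j)])" and ?bad = "\<phi> (h @ [((i, j), \<not> x i < x j)])"
      have "ennreal ?bad * ennreal p + ennreal ?good * ennreal (1 - p) =
          ennreal (?bad * p + ?good * (1 - p))"
        using p nonneg by (simp add: ennreal_mult)
      also have "\<dots> \<le> ennreal (\<phi> h)"
        using step[OF Query] by (intro ennreal_leI) (simp add: mult.commute add.commute)
      finally show ?thesis using p by (simp add: Query)
    qed (simp add: nn_integral_return_pmf)
  qed
  also note Suc
  finally show ?case .
qed

lemma length_transcript:
  assumes "h \<in> set_pmf (transcript p x \<sigma> t)"
  shows "(\<exists>k. \<sigma> h = Output k) \<or> length h = t"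
  using assms
proof (induction t arbitrary: h)
  case (Suc t)
  then obtain h' where h': "h' \<in> set_pmf (transcript p x \<sigma> t)"
    and h: "h \<in> set_pmf (case \<sigma> h' of
      Query i j \<Rightarrow> map_pmf (\<lambda>z. h' @ [((i, j), (x i < x j) \<noteq> z)]) (bernoulli_pmf p)
    | Output k \<Rightarrow> return_pmf h')"
    by (auto simp: set_bind_pmf)
  show ?case
    using Suc.IH[OF h'] h by (cases "\<sigma> h'") auto
qed simp

lemma execution_return: "execution p x (return_pmf \<sigma>) t = map_pmf (Pair \<sigma>) (transcript p x \<sigma> t)"
  by (simp add: execution_def bind_return_pmf)

text \<open>Since \<open>V\<close> drops by at least 1 per query on average, \<open>V\<close> plus
  the number of queries so far is a supermartingale; \<open>V\<close> itself, being nonnegative, may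
  then be discarded.\<close>

lemma expected_queries_return_le:
  assumes p: "0 \<le> p" "p \<le> 1" and V: "\<And>h. 0 \<le> V h"
    and step: "\<And>h i j. \<sigma> h = Query i j \<Longrightarrow>
      (1 - p) * V (h @ [((i, j), x i < x j)]) + p * V (h @ [((i, j), \<not> x i < x j)]) + 1 \<le> V h"
  shows "expected_queries p x (return_pmf \<sigma>) \<le> ennreal (V [])"
  unfolding expected_queries_def
proof (rule SUP_least)
  fix t
  have "(\<integral>\<^sup>+ (\<sigma>, h). of_nat (length h) \<partial>measure_pmf (execution p x (return_pmf \<sigma>) t)) =
        (\<integral>\<^sup>+ h. of_nat (length h) \<partial>measure_pmf (transcript p x \<sigma> t))"
    by (simp add: execution_return)
  also have "\<dots> \<le> (\<integral>\<^sup>+ h. ennreal (V h + real (length h)) \<partial>measure_pmf (transcript p x \<sigma> t))"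
    by (intro nn_integral_mono) (simp add: ennreal_of_nat_eq_real_of_nat V)
  also have "\<dots> \<le> ennreal (V [] + real (length ([] :: history)))"
  proof (rule nn_integral_transcript_le[OF p])
    fix h i j
    assume "\<sigma> h = Query i j"
    from step[OF this] show "(1 - p) *
        (V (h @ [((i, j), x i < x j)]) + real (length (h @ [((i, j), x i < x j)]))) +
      p * (V (h @ [((i, j), \<not> x i < x j)]) + real (length (h @ [((i, j), \<not> x i < x j)])))
      \<le> V h + real (length h)"
      by (simp add: algebra_simps)
  qed (simp add: V)
  finally show "(\<integral>\<^sup>+ (\<sigma>, h). of_nat (length h) \<partial>measure_pmf (execution p x (return_pmf \<sigma>) t))
    \<le> ennreal (V [])"
    by simp
qed

text \<open>At time \<open>t\<close> a run is either stopped, and an error there is charged to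
  \<open>W\<close>, or has made exactly \<open>t\<close> queries, which by Markov's inequality has
  probability at most \<open>C / t\<close>. Letting \<open>t\<close> grow removes the second
  term.\<close>

lemma error_prob_return_le:
  assumes p: "0 \<le> p" "p \<le> 1" and W: "\<And>h. 0 \<le> W h"
    and step: "\<And>h i j. \<sigma> h = Query i j \<Longrightarrow>
      (1 - p) * W (h @ [((i, j), x i < x j)]) + p * W (h @ [((i, j), \<not> x i < x j)]) \<le> W h"
    and wrong: "\<And>h k. \<sigma> h = Output k \<Longrightarrow> k \<noteq> arg_max_on x {..<n} \<Longrightarrow> 1 \<le> W h"
    and C: "0 \<le> C" and fin: "expected_queries p x (return_pmf \<sigma>) \<le> ennreal C"
  shows "error_prob p n x (return_pmf \<sigma>) \<le> W []"
proof -
  let ?P = "\<lambda>t. measure_pmf.prob (execution p x (return_pmf \<sigma>) t)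
      {(\<sigma>, h). \<sigma> h \<noteq> Output (arg_max_on x {..<n})}"
  have bound: "?P t \<le> W [] + C / real t" if t: "t > 0" for t
  proof -
    let ?M = "measure_pmf (transcript p x \<sigma> t)"
    let ?B = "{h. \<sigma> h \<noteq> Output (arg_max_on x {..<n})}"
    have "ennreal (?P t) = emeasure ?M ?B"
      by (simp add: execution_return measure_pmf.emeasure_eq_measure vimage_def)
    also have "\<dots> = (\<integral>\<^sup>+ h. indicator ?B h \<partial>?M)"
      by simp
    also have "\<dots> \<le> (\<integral>\<^sup>+ h. ennreal (W h) + ennreal (1 / real t) * of_nat (length h) \<partial>?M)"
    proof (rule nn_integral_mono_AE, unfold AE_measure_pmf_iff, intro ballI)
      fix h assume "h \<in> set_pmf (transcript p x \<sigma> t)"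
      from length_transcript[OF this] show "indicator ?B h \<le>
          ennreal (W h) + ennreal (1 / real t) * of_nat (length h)"
      proof
        assume "\<exists>k. \<sigma> h = Output k"
        then have "indicator ?B h \<le> ennreal (W h)"
          using wrong[of h] by (auto split: split_indicator)
        then show ?thesis by (rule order_trans) simp
      next
        assume "length h = t"
        then have "ennreal (1 / real t) * of_nat (length h) = 1"
          using t by (simp add: ennreal_of_nat_eq_real_of_nat ennreal_mult[symmetric])
        then show ?thesis by (auto split: split_indicator)
      qed
    qed
    also have "\<dots> = (\<integral>\<^sup>+ h. ennreal (W h) \<partial>?M) +
        ennreal (1 / real t) * (\<integral>\<^sup>+ h. of_nat (length h) \<partial>?M)"
      by (simp add: nn_integral_add nn_integral_cmult)
    also have "\<dots> \<le> ennreal (W []) + ennreal (1 / real t) * ennreal (C)"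
    proof (intro add_mono mult_left_mono)
      show "(\<integral>\<^sup>+ h. ennreal (W h) \<partial>?M) \<le> ennreal (W [])"
        using p W step by (rule nn_integral_transcript_le)
      have "(\<integral>\<^sup>+ h. of_nat (length h) \<partial>?M) \<le> expected_queries p x (return_pmf \<sigma>)"
        unfolding expected_queries_def by (rule SUP_upper2[of t]) (simp_all add: execution_return)
      also note fin
      finally show "(\<integral>\<^sup>+ h. of_nat (length h) \<partial>?M) \<le> ennreal (C)" .
    qed simp
    also have "\<dots> = ennreal (W [] + C / real t)"
      using W C by (simp add: ennreal_mult[symmetric] ennreal_plus[symmetric] del: ennreal_plus)
    finally show ?thesis
      using W C by (subst (asm) ennreal_le_iff) (simp_all add: add_nonneg_nonneg)
  qed
  have "error_prob p n x (return_pmf \<sigma>) \<le> W [] + C / real (Suc t)" for t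
    unfolding error_prob_def
    using bound[of "Suc t"] by (intro cINF_lower2[of _ _ "Suc t"]) (auto intro!: bdd_belowI[of _ 0])
  moreover have "(\<lambda>t. W [] + C / real (Suc t)) \<longlonglongrightarrow> W [] + 0"
    by (intro tendsto_intros LIMSEQ_Suc[OF lim_const_over_n])
  ultimately show ?thesis
    by (intro LIMSEQ_le_const[of _ "W []"]) auto
qed

section \<open>The tournament on a queue\<close>

text \<open>The answer \<open>True\<close> claims that \<open>j\<close> exceeds \<open>i\<close>, so
  \<open>j\<close> survives at the upper threshold and \<open>i\<close> at the lower one. The index
  \<open>length r + 2\<close> is the queue length during the comparison.\<close>

fun challenge :: "(nat \<Rightarrow> nat) \<Rightarrow> nat list \<times> int \<Rightarrow> bool \<Rightarrow> nat list \<times> int" where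
  "challenge a (i # j # r, c) b =
     (let c' = if b then c + 1 else c - 1; k = int (a (length r + 2)) in
      if c' = k then (r @ [j], 0) else if c' = - k then (r @ [i], 0) else (i # j # r, c'))"
| "challenge a s b = s"

fun queue_action :: "nat list \<Rightarrow> action" where
  "queue_action [] = Output 0"
| "queue_action [k] = Output k"
| "queue_action (i # j # r) = Query i j"

definition queue_strategy :: "(nat \<Rightarrow> nat) \<Rightarrow> nat \<Rightarrow> strategy" where
  "queue_strategy a n h = queue_action (fst (play (challenge a) ([0..<n], 0) h))"

text \<open>The strict bound on the counter means that the current comparison is open and that one
  answer can reach a threshold but not overshoot it. Nonemptiness rules out the default
  \<open>Output 0\<close>.\<close>

fun queue_ok :: "(nat \<Rightarrow> nat) \<Rightarrow> nat \<Rightarrow> nat list \<times> int \<Rightarrow> bool" where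
  "queue_ok a n (q, c) \<longleftrightarrow> distinct q \<and> set q \<subseteq> {..<n} \<and> (n > 0 \<longrightarrow> q \<noteq> []) \<and> \<bar>c\<bar> < int (a (length q))"

text \<open>This is the counter oriented towards the truth: whichever item is larger, a correct
  answer raises it by 1 and a wrong one lowers it by 1.\<close>

definition lead :: "(nat \<Rightarrow> real) \<Rightarrow> nat \<Rightarrow> nat \<Rightarrow> int \<Rightarrow> int" where
  "lead x i j c = (if x i < x j then c else - c)"

section \<open>Validity and expected number of queries\<close>

locale thresholds =
  fixes a :: "nat \<Rightarrow> nat" and p :: real
  assumes a_pos: "\<And>k. 0 < a k" and p_pos: "0 < p" and p_less: "p < 1 / 2"
begin

lemma queue_ok_challenge: "queue_ok a n s \<Longrightarrow> queue_ok a n (challenge a s b)"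
  \<comment> \<open>After a verdict the queue has one element more than \<open>r\<close>, and the
    reset counter 0 must lie strictly below the threshold for that length.\<close>
  using a_pos[of "Suc (length (tl (tl (fst s))))"]
  by (induction a s b rule: challenge.induct) (auto simp: Let_def)

lemma queue_ok_play: "queue_ok a n (play (challenge a) ([0..<n], 0) h)"
  using a_pos by (intro play_invariant[of "queue_ok a n"] queue_ok_challenge) auto

lemma valid_queue_strategy: "valid_algorithm n (return_pmf (queue_strategy a n))"
  unfolding valid_algorithm_def
proof (intro ballI allI impI)
  fix \<sigma> h i j
  assume "\<sigma> \<in> set_pmf (return_pmf (queue_strategy a n))" "\<sigma> h = Query i j"
  then have "queue_action (fst (play (challenge a) ([0..<n], 0) h)) = Query i j"
    by (simp add: queue_strategy_def)
  then show "i < n \<and> j < n \<and> i \<noteq> j"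
    using queue_ok_play[of n h]
    by (cases "play (challenge a) ([0..<n], 0) h") (auto elim!: queue_action.elims)
qed

text \<open>
  The counter has drift \<open>1 - 2 * p\<close> towards the correct answer, so the linear function below
  decreases by \<open>1\<close> per query on average and dominates the expected remaining duration of the
  current comparison.
\<close>

fun remaining :: "(nat \<Rightarrow> real) \<Rightarrow> nat list \<times> int \<Rightarrow> real" where
  "remaining x (i # j # r, c) =
     (real (\<Sum>k\<in>{2..Suc (length r)}. a k) + real (a (length r + 2)) - real_of_int (lead x i j c)) / (1 - 2 * p)"
| "remaining x s = 0"

lemma remaining_fresh: "remaining x (q, 0) = real (\<Sum>k\<in>{2..length q}. a k) / (1 - 2 * p)"
  by (cases "(x, q, 0 :: int)" rule: remaining.cases) (auto simp: lead_def)

lemma remaining_nonneg: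
  assumes "queue_ok a n s"
  shows "0 \<le> remaining x s"
proof (cases "(x, s)" rule: remaining.cases)
  case (1 x' i j r c)
  then have "\<bar>c\<bar> < int (a (length r + 2))"
    using assms by simp
  then have "real_of_int (lead x i j c) \<le> real (a (length r + 2))"
    by (auto simp: lead_def)
  then have "0 \<le> real (\<Sum>k\<in>{2..Suc (length r)}. a k) + real (a (length r + 2)) - real_of_int (lead x i j c)"
    by linarith
  with 1 p_less show ?thesis by simp
qed simp_all

text \<open>A verdict removes the summand \<open>a (length r + 2) - lead\<close>, which is
  nonnegative because the counter cannot overshoot. Hence one linear formula bounds the potential
  whether or not the comparison ends, and only the drift is left to compute.\<close>

lemma remaining_challenge_le:
  assumes ok: "queue_ok a n (i # j # r, c)"
  shows "remaining x (challenge a (i # j # r, c) b) \<le>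
    (real (\<Sum>k\<in>{2..Suc (length r)}. a k) + real (a (length r + 2))
      - real_of_int (lead x i j (if b then c + 1 else c - 1))) / (1 - 2 * p)"
proof -
  define c' where "c' = (if b then c + 1 else c - 1)"
  have "\<bar>c'\<bar> \<le> int (a (length r + 2))"
    using ok by (auto simp: c'_def)
  then have "real_of_int (lead x i j c') \<le> real (a (length r + 2))"
    by (auto simp: lead_def)
  then have "remaining x (q, 0) \<le> (real (\<Sum>k\<in>{2..Suc (length r)}. a k) + real (a (length r + 2))
      - real_of_int (lead x i j c')) / (1 - 2 * p)" if "length q = Suc (length r)" for q
    using p_less that unfolding remaining_fresh by (intro divide_right_mono) auto
  moreover have "challenge a (i # j # r, c) b \<in> {(r @ [j], 0), (r @ [i], 0), (i # j # r, c')}"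
    by (auto simp: Let_def simp flip: c'_def)
  moreover have "remaining x (i # j # r, c') = (real (\<Sum>k\<in>{2..Suc (length r)}. a k)
      + real (a (length r + 2)) - real_of_int (lead x i j c')) / (1 - 2 * p)"
    by simp
  ultimately show ?thesis
    unfolding c'_def[symmetric] by (auto simp del: remaining.simps challenge.simps)
qed

lemma remaining_step:
  assumes ok: "queue_ok a n (i # j # r, c)"
  shows "(1 - p) * remaining x (challenge a (i # j # r, c) (x i < x j)) +
    p * remaining x (challenge a (i # j # r, c) (\<not> x i < x j)) + 1 \<le> remaining x (i # j # r, c)"
proof -
  define B where "B = real (\<Sum>k\<in>{2..Suc (length r)}. a k) + real (a (length r + 2))"
  define g where "g = real_of_int (lead x i j c)"
  have "remaining x (challenge a (i # j # r, c) (x i < x j)) \<le> (B - (g + 1)) / (1 - 2 * p)"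
    using remaining_challenge_le[OF ok, of x "x i < x j"]
    by (cases "x i < x j") (simp_all add: B_def g_def lead_def)
  moreover have "remaining x (challenge a (i # j # r, c) (\<not> x i < x j)) \<le> (B - (g - 1)) / (1 - 2 * p)"
    using remaining_challenge_le[OF ok, of x "\<not> x i < x j"]
    by (cases "x i < x j") (simp_all add: B_def g_def lead_def)
  ultimately have "(1 - p) * remaining x (challenge a (i # j # r, c) (x i < x j)) +
      p * remaining x (challenge a (i # j # r, c) (\<not> x i < x j)) + 1 \<le>
      (1 - p) * ((B - (g + 1)) / (1 - 2 * p)) + p * ((B - (g - 1)) / (1 - 2 * p)) + 1"
    using p_pos p_less by (intro add_mono mult_left_mono) auto
  also have "\<dots> = ((1 - p) * (B - (g + 1)) + p * (B - (g - 1)) + (1 - 2 * p)) / (1 - 2 * p)"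
    using p_less by (simp add: add_divide_distrib)
  also have "(1 - p) * (B - (g + 1)) + p * (B - (g - 1)) + (1 - 2 * p) = B - g"
    by (simp add: algebra_simps)
  finally show ?thesis
    by (simp add: B_def g_def)
qed

lemma queue_action_Query:
  "queue_action (fst s) = Query i j \<Longrightarrow> \<exists>r c. s = (i # j # r, c)"
  by (cases s) (auto elim: queue_action.elims)

lemma expected_queries_queue_strategy:
  "expected_queries p x (return_pmf (queue_strategy a n))
    \<le> ennreal (real (\<Sum>k\<in>{2..n}. a k) / (1 - 2 * p))"
proof -
  let ?s = "play (challenge a) ([0..<n], 0)"
  have "expected_queries p x (return_pmf (queue_strategy a n)) \<le> ennreal (remaining x (?s []))"
  proof (rule expected_queries_return_le)
    fix h i j
    assume "queue_strategy a n h = Query i j"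
    then obtain r c where s: "?s h = (i # j # r, c)"
      using queue_action_Query unfolding queue_strategy_def by blast
    show "(1 - p) * remaining x (?s (h @ [((i, j), x i < x j)])) +
        p * remaining x (?s (h @ [((i, j), \<not> x i < x j)])) + 1 \<le> remaining x (?s h)"
      using remaining_step[of n i j r c x] queue_ok_play[of n h]
      by (simp only: play_snoc s)
  next
    show "0 \<le> remaining x (?s h)" for h
      using remaining_nonneg[OF queue_ok_play] .
  qed (use p_pos p_less in auto)
  then show ?thesis
    by (simp add: remaining_fresh)
qed

end

section \<open>Error probability of the tournament\<close>

definition position :: "'a \<Rightarrow> 'a list \<Rightarrow> nat" where
  "position y q = length (takeWhile (\<lambda>z. z \<noteq> y) q)"

lemma position_Cons [simp]: "position y (z # q) = (if z = y then 0 else Suc (position y q))"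
  by (simp add: position_def)

lemma position_append_in: "y \<in> set q \<Longrightarrow> position y (q @ q') = position y q"
  by (simp add: position_def)

lemma position_append_notin: "y \<notin> set q \<Longrightarrow> position y (q @ [y]) = length q"
  by (induction q) (auto simp: position_def)

lemma position_less: "y \<in> set q \<Longrightarrow> position y q < length q"
  by (induction q) auto

locale max_search = thresholds +
  fixes \<beta> :: real and x :: "nat \<Rightarrow> real" and n m :: nat
  assumes \<beta>_nonneg: "0 \<le> \<beta>"
    and threshold: "\<And>k. 2 \<le> k \<Longrightarrow> (p / (1 - p)) ^ a k \<le> \<beta> * (real k - 1)"
    and m_less: "m < n" and m_max: "\<And>i. i < n \<Longrightarrow> i \<noteq> m \<Longrightarrow> x i < x m"
begin

text \<open>
  While the maximum waits, the length \<open>k\<close> of the queue and its position \<open>j\<close> change to \<open>k - 1\<close> and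
  \<open>j - 2\<close>, so \<open>2 * k - j\<close> is invariant; a win moves it to position \<open>k - 2\<close> of a queue of length
  \<open>k - 1\<close>, where this value is \<open>k\<close>. This makes a budget linear in \<open>2 * k - j\<close> affordable. The
  power of \<open>p / (1 - p)\<close> is the exponential martingale of the counter, equal to \<open>1\<close> when the
  current comparison is lost.
\<close>

fun risk :: "nat list \<times> int \<Rightarrow> real" where
  "risk (q, c) =
     (if m \<notin> set q then 1
      else if 2 \<le> length q \<and> position m q < 2
        then \<beta> * (real (length q) - 2) + (p / (1 - p)) powi (int (a (length q)) + lead x (q ! 0) (q ! 1) c)
      else \<beta> * (2 * real (length q) - real (position m q) - 2))"

text \<open>For a maximum at position at most 1 of \<open>k\<close> items, the budget
  \<open>2 * k - j - 2\<close> is at least \<open>(k - 2) + (k - 1)\<close>: the part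
  \<open>k - 1\<close> pays for the comparison by \<open>threshold\<close>, and \<open>k - 2\<close>
  is what the maximum needs after winning.\<close>

lemma risk_fresh:
  assumes "m \<in> set q"
  shows "risk (q, 0) \<le> \<beta> * (2 * real (length q) - real (position m q) - 2)"
proof (cases "2 \<le> length q \<and> position m q < 2")
  case True
  then have "risk (q, 0) = \<beta> * (real (length q) - 2) + (p / (1 - p)) ^ a (length q)"
    using assms by (simp add: lead_def)
  also have "\<dots> \<le> \<beta> * (real (length q) - 2) + \<beta> * (real (length q) - 1)"
    using True threshold by simp
  also have "\<dots> = \<beta> * (2 * real (length q) - 1 - 2)"
    by (simp add: algebra_simps)
  also have "\<dots> \<le> \<beta> * (2 * real (length q) - real (position m q) - 2)"
    using True \<beta>_nonneg by (intro mult_left_mono) auto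
  finally show ?thesis .
qed (use assms in auto)

lemma risk_nonneg: "0 \<le> risk (q, c)"
  using \<beta>_nonneg p_pos p_less position_less[of m q]
  by (cases "length q") (auto intro!: add_nonneg_nonneg mult_nonneg_nonneg)

text \<open>The formula for an open comparison also covers both verdicts. A win puts the maximum
  last among \<open>length r + 1\<close> items, where the budget is \<beta> times
  \<open>length r\<close>; a loss brings the exponent to 0, so the power alone equals the risk
  1.\<close>

lemma risk_challenge_contender:
  fixes b :: bool
  assumes ok: "queue_ok a n (i # j # r, c)" and m: "m = i \<or> m = j"
  defines "c' \<equiv> if b then c + 1 else c - 1"
  shows "risk (challenge a (i # j # r, c) b) \<le>
    \<beta> * real (length r) + (p / (1 - p)) powi (int (a (length r + 2)) + lead x i j c')"
proof -
  let ?k = "int (a (length r + 2))"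
  let ?R = "\<beta> * real (length r) + (p / (1 - p)) powi (?k + lead x i j c')"
  have ij: "i < n" "j < n" "i \<noteq> j" "m \<notin> set r"
    using ok m by auto
  have lead: "lead x i j c' = (if m = j then c' else - c')"
    using m_max[of i] m_max[of j] ij m by (auto simp: lead_def)
  have pos: "0 \<le> (p / (1 - p)) powi l" for l
    using p_pos p_less by simp
  have won: "risk (r @ [m], 0) \<le> ?R"
    using risk_fresh[of "r @ [m]"] position_append_notin[OF ij(4)] pos[of "?k + lead x i j c'"]
    by simp
  have lost: "risk (r @ [l], 0) \<le> ?R" if "l \<noteq> m" "?k + lead x i j c' = 0" for l
    using ij(4) that \<beta>_nonneg by (simp add: mult_nonneg_nonneg)
  have k: "0 < ?k"
    using a_pos by simp
  consider "c' = ?k" | "c' = - ?k" | "c' \<noteq> ?k" "c' \<noteq> - ?k" by blast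
  then show ?thesis
  proof cases
    case 1
    then have "challenge a (i # j # r, c) b = (r @ [j], 0)"
      by (simp add: Let_def c'_def)
    then show ?thesis
      using won lost[of j] lead m 1 by (cases "m = j") (simp_all del: risk.simps)
  next
    case 2
    then have "challenge a (i # j # r, c) b = (r @ [i], 0)"
      using k by (simp add: Let_def flip: c'_def)
    then show ?thesis
      using won lost[of i] lead m 2 ij by (cases "m = j") (simp_all del: risk.simps)
  next
    case 3
    then have "challenge a (i # j # r, c) b = (i # j # r, c')"
      by (simp add: Let_def flip: c'_def)
    then show ?thesis
      using m by auto
  qed
qed

text \<open>The linear budget is constant while the maximum waits, and \<open>risk_fresh\<close>
  covers the moment when it reaches the front.\<close>

lemma risk_challenge_waiting:
  assumes ok: "queue_ok a n (i # j # r, c)" and m: "m \<in> set r"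
  shows "risk (challenge a (i # j # r, c) b) \<le> risk (i # j # r, c)"
proof -
  have ij: "i \<noteq> m" "j \<noteq> m"
    using ok m by auto
  have "risk (r @ [l], 0) \<le> risk (i # j # r, c)" for l
    using risk_fresh[of "r @ [l]"] m ij by (simp add: position_append_in algebra_simps)
  moreover have "risk (i # j # r, c') \<le> risk (i # j # r, c)" for c'
    using m ij by simp
  ultimately show ?thesis
    by (simp add: Let_def del: risk.simps)
qed

lemma risk_challenge_lost:
  assumes "m \<noteq> i" "m \<noteq> j" "m \<notin> set r"
  shows "risk (challenge a (i # j # r, c) b) = 1"
  using assms by (simp add: Let_def)

lemma risk_step:
  assumes ok: "queue_ok a n (i # j # r, c)"
  shows "(1 - p) * risk (challenge a (i # j # r, c) (x i < x j)) +
    p * risk (challenge a (i # j # r, c) (\<not> x i < x j)) \<le> risk (i # j # r, c)"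
proof -
  consider "m = i \<or> m = j" | "m \<in> set r" | "m \<noteq> i" "m \<noteq> j" "m \<notin> set r" by blast
  then show ?thesis
  proof cases
    case 1
    define \<rho> where "\<rho> = p / (1 - p)"
    have \<rho>: "0 < \<rho>" using p_pos p_less by (simp add: \<rho>_def)
    define e where "e = int (a (length r + 2)) + lead x i j c"
    let ?F = "\<beta> * real (length r)"
    have "risk (challenge a (i # j # r, c) (x i < x j)) \<le> ?F + \<rho> powi (e + 1)"
    proof -
      have "int (a (length r + 2)) + lead x i j (if x i < x j then c + 1 else c - 1) = e + 1"
        by (simp add: e_def lead_def)
      with risk_challenge_contender[OF ok 1, of "x i < x j"] show ?thesis
        by (simp only: \<rho>_def)
    qed
    moreover have "risk (challenge a (i # j # r, c) (\<not> x i < x j)) \<le> ?F + \<rho> powi (e - 1)"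
    proof -
      have "int (a (length r + 2)) + lead x i j (if \<not> x i < x j then c + 1 else c - 1) = e - 1"
        by (simp add: e_def lead_def)
      with risk_challenge_contender[OF ok 1, of "\<not> x i < x j"] show ?thesis
        by (simp only: \<rho>_def)
    qed
    ultimately have "(1 - p) * risk (challenge a (i # j # r, c) (x i < x j)) +
        p * risk (challenge a (i # j # r, c) (\<not> x i < x j)) \<le>
        (1 - p) * (?F + \<rho> powi (e + 1)) + p * (?F + \<rho> powi (e - 1))"
      using p_pos p_less by (intro add_mono mult_left_mono) auto
    also have "\<dots> = ?F + \<rho> powi e * ((1 - p) * \<rho> + p / \<rho>)"
      using \<rho> by (simp add: power_int_add power_int_diff algebra_simps)
    \<comment> \<open>This is the martingale condition: \<rho> is the root other than 1 of
      \<open>(1 - p) * z + p / z = 1\<close>.\<close>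
    also have "(1 - p) * \<rho> + p / \<rho> = 1"
      using p_pos p_less by (simp add: \<rho>_def)
    finally show ?thesis
      using 1 by (auto simp: \<rho>_def e_def simp del: challenge.simps)
  next
    case 2
    then have "(1 - p) * risk (challenge a (i # j # r, c) (x i < x j)) +
        p * risk (challenge a (i # j # r, c) (\<not> x i < x j)) \<le>
        (1 - p) * risk (i # j # r, c) + p * risk (i # j # r, c)"
      using p_pos p_less risk_challenge_waiting[OF ok]
      by (intro add_mono mult_left_mono) (auto simp del: challenge.simps risk.simps)
    also have "\<dots> = risk (i # j # r, c)"
      by (simp add: algebra_simps del: risk.simps)
    finally show ?thesis .
  next
    case 3
    then show ?thesis
      by (simp add: risk_challenge_lost del: challenge.simps risk.simps) simp
  qed
qed

lemma error_prob_queue_strategy: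
  "error_prob p n x (return_pmf (queue_strategy a n)) \<le> \<beta> * (2 * (real n - 1))"
proof -
  let ?s = "play (challenge a) ([0..<n], 0)"
  \<comment> \<open>\<open>arg_max_on\<close> is a choice among maximisers, and here there is only
    one.\<close>
  have m: "arg_max_on x {..<n} = m"
    unfolding arg_max_on_def arg_max_def is_arg_max_def
  proof (rule some_equality)
    show "m \<in> {..<n} \<and> \<not> (\<exists>y. y \<in> {..<n} \<and> x m < x y)"
      using m_less m_max by (metis lessThan_iff less_asym)
    show "k = m" if "k \<in> {..<n} \<and> \<not> (\<exists>y. y \<in> {..<n} \<and> x k < x y)" for k
      using that m_less m_max by (metis lessThan_iff)
  qed
  have "error_prob p n x (return_pmf (queue_strategy a n)) \<le> risk (?s [])"
  proof (rule error_prob_return_le)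
    fix h i j
    assume "queue_strategy a n h = Query i j"
    then obtain r c where s: "?s h = (i # j # r, c)"
      using queue_action_Query unfolding queue_strategy_def by blast
    show "(1 - p) * risk (?s (h @ [((i, j), x i < x j)])) +
        p * risk (?s (h @ [((i, j), \<not> x i < x j)])) \<le> risk (?s h)"
      using risk_step[of i j r c] queue_ok_play[of n h]
      by (simp only: play_snoc s)
  next
    fix h k
    assume "queue_strategy a n h = Output k" "k \<noteq> arg_max_on x {..<n}"
    \<comment> \<open>The queue is a singleton other than \<open>[m]\<close>, so the maximum has
      been eliminated and the risk is 1.\<close>
    then show "1 \<le> risk (?s h)"
      using queue_ok_play[of n h] m_less unfolding queue_strategy_def m
      by (cases "?s h") (auto elim!: queue_action.elims)
  next
    show "0 \<le> risk (?s h)" for h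
      using risk_nonneg by (cases "?s h") (simp del: risk.simps)
    show "0 \<le> real (\<Sum>k\<in>{2..n}. a k) / (1 - 2 * p)"
      using p_less by (intro divide_nonneg_nonneg of_nat_0_le_iff) simp
  qed (use p_pos p_less expected_queries_queue_strategy in auto)
  also have "\<dots> \<le> \<beta> * (2 * real n - real (position m [0..<n]) - 2)"
    using risk_fresh[of "[0..<n]"] m_less by simp
  also have "\<dots> \<le> \<beta> * (2 * (real n - 1))"
    using \<beta>_nonneg by (intro mult_left_mono) auto
  finally show ?thesis .
qed

end

section \<open>Choice of the thresholds and total cost\<close>

text \<open>This is the crude Stirling bound \<open>ln (n ^ n / fact n) \<le> n\<close>; it makes
  the dependence of the thresholds on the queue length cost only O(n) overall.\<close>

lemma sum_ln_quotient_le: "(\<Sum>i=1..n. ln (real n / real i)) \<le> real n"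
proof (induction n)
  case (Suc n)
  show ?case
  proof (cases "n = 0")
    case False
    have "(\<Sum>i=1..Suc n. ln (real (Suc n) / real i)) =
        (\<Sum>i=1..n. ln (real n / real i) + ln (real (Suc n) / real n))"
      using False by (simp, intro sum.cong refl) (auto simp: ln_div)
    also have "\<dots> = (\<Sum>i=1..n. ln (real n / real i)) + real n * ln (real (Suc n) / real n)"
      by (simp add: sum.distrib)
    also have "\<dots> \<le> real n + real n * (1 / real n)"
    proof (intro add_mono mult_left_mono)
      have "real (Suc n) / real n = 1 + 1 / real n"
        using False by (simp add: field_simps)
      then show "ln (real (Suc n) / real n) \<le> 1 / real n"
        using ln_add_one_self_le_self[of "1 / real n"] by simp
    qed (use Suc in auto)
    finally show ?thesis
      using False by simp
  qed simp
qed simp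

text \<open>In the additive constant, \<open>ln ((1 - p) / p)\<close> comes from rounding the
  thresholds up, \<open>ln 2\<close> from the factor 2 in the error budget, and 1 from averaging
  \<open>ln (n / i)\<close>.\<close>

lemma noisy_max_algorithm:
  fixes p d :: real
  assumes p: "0 < p" "p < 1 / 2" and d: "0 < d" "d < 1" and n: "1 \<le> n"
  shows "\<exists>A. valid_algorithm n A \<and> (\<forall>x. inj_on x {..<n} \<longrightarrow> error_prob p n x A \<le> d \<and>
    expected_queries p x A \<le>
      ennreal (real n * (ln (1 / d) + (ln ((1 - p) / p) + ln 2 + 1)) / D_KL p (1 - p)))"
proof -
  define L where "L = ln ((1 - p) / p)"
  have L: "0 < L"
    using p unfolding L_def by (intro ln_gt_zero) (simp add: field_simps)
  \<comment> \<open>The total error bound \<open>\<beta> * (2 * (real n - 1))\<close> is then at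
    most \<open>d\<close>.\<close>
  define \<beta> where "\<beta> = d / (2 * real n)"
  have \<beta>: "0 < \<beta>"
    using d n by (simp add: \<beta>_def)
  \<comment> \<open>This is the real exponent at which the power of \<open>p / (1 - p)\<close>
    equals \<open>\<beta> * (real k - 1)\<close>.\<close>
  define y where "y k = ln (1 / (\<beta> * (real k - 1))) / L" for k
  \<comment> \<open>The successor of the floor dominates \<open>y k\<close> and stays positive even
    when \<open>y k\<close> is negative.\<close>
  define a where "a k = Suc (nat \<lfloor>y k\<rfloor>)" for k
  interpret thresholds a p
    using p by unfold_locales (auto simp: a_def)
  have threshold: "(p / (1 - p)) ^ a k \<le> \<beta> * (real k - 1)" if k: "2 \<le> k" for k
  proof -
    have pos: "0 < \<beta> * (real k - 1)"
      using \<beta> k by simp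
    have "p / (1 - p) = exp (- L)"
      using p by (simp add: L_def exp_minus)
    then have "(p / (1 - p)) ^ a k = exp (- (real (a k) * L))"
      by (simp flip: exp_of_nat_mult)
    also have "\<dots> \<le> exp (- (y k * L))"
      using L unfolding a_def by (simp del: of_nat_Suc) linarith
    also have "\<dots> = \<beta> * (real k - 1)"
      using L pos by (auto simp: y_def ln_div)
    finally show ?thesis .
  qed
  have error: "error_prob p n x (return_pmf (queue_strategy a n)) \<le> d"
    if inj: "inj_on x {..<n}" for x
  proof -
    have "Max (x ` {..<n}) \<in> x ` {..<n}"
      using n by (intro Max_in) (auto simp: lessThan_empty_iff)
    then obtain m where m: "m < n" "x m = Max (x ` {..<n})"
      by auto
    interpret max_search a p \<beta> x n m
    proof unfold_locales
      fix i assume i: "i < n" "i \<noteq> m"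
      then have "x i \<le> x m" "x i \<noteq> x m"
        using m inj_onD[OF inj, of i m] by auto
      then show "x i < x m" by simp
    qed (use \<beta> threshold m in auto)
    have "error_prob p n x (return_pmf (queue_strategy a n)) \<le> \<beta> * (2 * (real n - 1))"
      by (rule error_prob_queue_strategy)
    also have "\<dots> \<le> \<beta> * (2 * real n)"
      using \<beta> by simp
    also have "\<dots> = d"
      using n by (simp add: \<beta>_def)
    finally show ?thesis .
  qed
  have a_le: "real (a (Suc i)) \<le> 1 + (ln (1 / d) + ln 2 + ln (real n / real i)) / L"
    if i: "1 \<le> i" "i \<le> n" for i
  proof -
    have y: "y (Suc i) = (ln (1 / d) + ln 2 + ln (real n / real i)) / L"
      using i d by (simp add: y_def \<beta>_def ln_div ln_mult)
    have "0 \<le> y (Suc i)"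
      unfolding y using i d L by (intro divide_nonneg_nonneg add_nonneg_nonneg) auto
    then have "real (a (Suc i)) \<le> 1 + y (Suc i)"
      unfolding a_def by linarith
    then show ?thesis by (simp add: y)
  qed
  have "real (\<Sum>k\<in>{2..n}. a k) = (\<Sum>i\<in>{1..n - 1}. real (a (Suc i)))"
    using sum.shift_bounds_cl_Suc_ivl[of "\<lambda>k. real (a k)" 1 "n - 1"] n
    by (simp add: numeral_2_eq_2)
  \<comment> \<open>The extra term \<open>i = n\<close> completes the range of the logarithmic
    sum.\<close>
  also have "\<dots> \<le> (\<Sum>i\<in>{1..n}. real (a (Suc i)))"
    by (rule sum_mono2) auto
  also have "\<dots> \<le> (\<Sum>i\<in>{1..n}. 1 + (ln (1 / d) + ln 2 + ln (real n / real i)) / L)"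
    by (rule sum_mono) (use a_le in auto)
  also have "\<dots> = real n * (1 + (ln (1 / d) + ln 2) / L) + (\<Sum>i\<in>{1..n}. ln (real n / real i)) / L"
    by (simp add: sum.distrib add_divide_distrib sum_divide_distrib algebra_simps)
  also have "\<dots> \<le> real n * (1 + (ln (1 / d) + ln 2) / L) + real n / L"
    using L by (intro add_left_mono divide_right_mono sum_ln_quotient_le) auto
  also have "\<dots> = real n * (ln (1 / d) + (L + ln 2 + 1)) / L"
    using L by (simp add: field_simps)
  finally have "real (\<Sum>k\<in>{2..n}. a k) / (1 - 2 * p) \<le>
      real n * (ln (1 / d) + (L + ln 2 + 1)) / L / (1 - 2 * p)"
    using p by (intro divide_right_mono) auto
  also have "\<dots> = real n * (ln (1 / d) + (L + ln 2 + 1)) / D_KL p (1 - p)"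
    using p by (simp add: D_KL_complement L_def mult.commute)
  finally have "expected_queries p x (return_pmf (queue_strategy a n)) \<le>
      ennreal (real n * (ln (1 / d) + (L + ln 2 + 1)) / D_KL p (1 - p))" for x
    using expected_queries_queue_strategy[of x n] by (meson ennreal_leI order_trans)
  with valid_queue_strategy error show ?thesis
    unfolding L_def by blast
qed

section \<open>Large error levels and the limit\<close>

text \<open>Finitely many \<open>\<delta> n\<close> may be at least 1. The claimed query bound can
  then be zero or negative, hence 0 under \<open>ennreal\<close>, so no query may be made.\<close>

lemma no_query_algorithm:
  assumes "1 \<le> d"
  defines "A \<equiv> return_pmf (\<lambda>_. Output 0)"
  shows "valid_algorithm n A" "error_prob p n x A \<le> d" "expected_queries p x A = 0"
proof -
  have transcript: "transcript p x (\<lambda>_. Output 0) t = return_pmf []" for t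
    by (induction t) (simp_all add: bind_return_pmf)
  show "valid_algorithm n A"
    by (simp add: A_def valid_algorithm_def)
  have "error_prob p n x A \<le> 1"
    unfolding error_prob_def
    by (rule cINF_lower2[of _ _ 0]) (auto intro!: bdd_belowI[of _ 0])
  with assms(1) show "error_prob p n x A \<le> d" by simp
  show "expected_queries p x A = 0"
    by (simp add: expected_queries_def A_def execution_return transcript nn_integral_return_pmf)
qed

theorem theorem4:
  fixes p :: real and \<delta> :: "nat \<Rightarrow> real"
  assumes "0 < p" and "p < 1 / 2"
    and "\<And>n. n \<ge> 1 \<Longrightarrow> 0 < \<delta> n"
    and "\<delta> \<longlonglongrightarrow> 0"
  shows "\<exists>(A :: nat \<Rightarrow> algorithm) (\<epsilon> :: nat \<Rightarrow> real). \<epsilon> \<longlonglongrightarrow> 0 \<and>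
           (\<forall>n\<ge>1. valid_algorithm n (A n) \<and>
             (\<forall>x. inj_on x {..<n} \<longrightarrow>
                error_prob p n x (A n) \<le> \<delta> n \<and>
                expected_queries p x (A n) \<le>
                  ennreal ((1 + \<epsilon> n) * (real n * ln (1 / \<delta> n) / D_KL p (1 - p)))))"
proof -
  define K where "K = ln ((1 - p) / p) + ln 2 + 1"
  \<comment> \<open>This is \<open>K / ln (1 / \<delta> n)\<close>, the additive constant relative
    to the main term; it vanishes because \<open>ln (\<delta> n)\<close> diverges.\<close>
  define \<epsilon> where "\<epsilon> n = - K / ln (\<delta> n)" for n
  have "filterlim \<delta> (at_right 0) sequentially"
    unfolding filterlim_at using assms(4)
    by (auto intro!: eventually_mono[OF eventually_ge_at_top[of 1]] dest!: assms(3))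
  then have "filterlim (\<lambda>n. ln (\<delta> n)) at_infinity sequentially"
    by (intro filterlim_at_bot_imp_at_infinity filterlim_compose[OF ln_at_0])
  then have \<epsilon>: "\<epsilon> \<longlonglongrightarrow> 0"
    unfolding \<epsilon>_def by (intro tendsto_divide_0[OF tendsto_const])
  have "\<exists>A. valid_algorithm n A \<and> (\<forall>x. inj_on x {..<n} \<longrightarrow> error_prob p n x A \<le> \<delta> n \<and>
      expected_queries p x A \<le>
        ennreal ((1 + \<epsilon> n) * (real n * ln (1 / \<delta> n) / D_KL p (1 - p))))" if n: "n \<ge> 1" for n
  proof (cases "\<delta> n < 1")
    case True
    then have "ln (\<delta> n) < 0"
      using assms(3)[OF n] by simp
    then have "ln (1 / \<delta> n) + K = (1 + \<epsilon> n) * ln (1 / \<delta> n)"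
      using assms(3)[OF n] by (simp add: \<epsilon>_def ln_div field_simps)
    then have cost: "real n * (ln (1 / \<delta> n) + K) / D_KL p (1 - p) =
        (1 + \<epsilon> n) * (real n * ln (1 / \<delta> n) / D_KL p (1 - p))"
      by simp
    show ?thesis
      using noisy_max_algorithm[OF assms(1,2) assms(3)[OF n] True n]
      unfolding K_def[symmetric] cost .
  next
    case False
    then show ?thesis
      using no_query_algorithm[of "\<delta> n"] by (intro exI[of _ "return_pmf (\<lambda>_. Output 0)"]) simp
  qed
  then show ?thesis
    using \<epsilon> by metis
qed

end
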